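(* Let $q$ be a complex number with $|q|<1$. Then $$\sum_{i,j,k\ge 0}\frac{q^{i^2+2j^2+4k^2+2ik+4jk+2j+2k}\,(1+q^{2i+2j+4k+2})}{(q^2;q^2)_i(q^2;q^2)_j(q^4;q^4)_k} = \frac{(q^3,q^8,q^{11};q^{11})_\infty}{(q;q^2)_\infty(q^4;q^4)_\infty}.$$
   Context: For $|q|<1$: $(a;q)_\infty=\prod_{m=0}^\infty(1-aq^m)$, $(a;q)_n=(a;q)_\infty/(aq^n;q)_\infty=\prod_{m=0}^{n-1}(1-aq^m)$ for integers $n\ge0$, and $(a_1,\dots,a_r;q)_\infty=(a_1;q)_\infty\cdots(a_r;q)_\infty$; the same notation is used with the base $q$ replaced by a power of $q$. *)

theory Defs
  imports "HOL-Analysis.Analysis"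
begin

definition qpoch :: "complex \<Rightarrow> complex \<Rightarrow> nat \<Rightarrow> complex" where
  "qpoch a q n = (\<Prod>m<n. 1 - a * q ^ m)"

(* Meaningful for norm q < 1, where the product converges in the sense of has_prod;
   that notion allows finitely many zero factors. *)
definition qpoch_inf :: "complex \<Rightarrow> complex \<Rightarrow> complex" where
  "qpoch_inf a q = (\<Prod>m. 1 - a * q ^ m)"

definition qpoch_inf_list :: "complex list \<Rightarrow> complex \<Rightarrow> complex" where
  "qpoch_inf_list as q = (\<Prod>a\<leftarrow>as. qpoch_inf a q)"

end

theory Submission
  imports Defs
begin

text \<open>
  Put \<open>Q = q^2\<close> and \<open>n = j + k\<close>. The exponent of the summand is then
  \<open>2(n^2 + n) + 2k^2 + (i^2 + 2ik)\<close>, so \<open>i\<close> occurs only in two sums of Euler's type. Carrying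
  them out turns the triple sum into \<open>(-q;q^2)_\<infinity>\<close> times
  \<open>\<Sum>n. Q^(n^2+n) \<Sum>k. Q^(k^2) (b_k + Q^(n+k+1) b'_k) / (Q;Q)_(n-k)\<close>, where
  \<open>b_k = 1 / ((q^4;q^4)_k (-q;q^2)_k)\<close> and \<open>b'_k = 1 / ((q^4;q^4)_k (-q;q^2)_(k+1))\<close>.

  The decisive fact is \<open>bailey_pair\<close>: with the one bilateral sequence
  \<open>c_r = (-1)^r q^(r(3r+1)/2)\<close>,
  \<open>b_k = \<Sum>r. c_r / ((Q;Q)_(k-r) (Q;Q)_(k+r))\<close> and
  \<open>b'_k = \<Sum>r. c_r / ((Q;Q)_(k-r) (Q;Q)_(k+r+1))\<close>.
  So \<open>b\<close> and \<open>b'\<close> belong to Bailey pairs relative to \<open>1\<close> and to \<open>Q\<close> which share their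
  coefficients. One step of Bailey's lemma, which is the q-Vandermonde sum, applies to each, and
  because the coefficients agree the two results combine termwise to
  \<open>\<Sum>r. c_r Q^(r^2) / ((Q;Q)_(n-r) (Q;Q)_(n+r+1))\<close> (lemma \<open>bailey_step\<close>). The unusual factor
  \<open>1 + q^(2i+2j+4k+2)\<close> in the summand is exactly what makes this combination possible.

  Finally the sum over \<open>n\<close> is the limit \<open>durfee_rectangle\<close> of the q-Vandermonde sum and leaves
  \<open>\<Sum>r. c_r Q^(2r^2+r)\<close>, which is \<open>\<Sum>r. (-1)^r q^((11r^2+5r)/2)\<close>, over \<open>(Q;Q)_\<infinity>\<close>
  (lemma \<open>bilateral_evaluation\<close>); the Jacobi triple product evaluates
  the theta series. The triple product itself is the product of two of Euler's expansions, with
  \<open>durfee_rectangle\<close> summing each coefficient.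

  Bilateral sums use integer powers and hence need \<open>q \<noteq> 0\<close>; at \<open>q = 0\<close> both sides are 1.
\<close>

section \<open>Finite and infinite q-shifted factorials\<close>

lemma qpoch_0 [simp]: "qpoch a q 0 = 1"
  by (simp add: qpoch_def)

lemma qpoch_Suc: "qpoch a q (Suc n) = qpoch a q n * (1 - a * q ^ n)"
  by (simp add: qpoch_def)

lemma qpoch_add: "qpoch a q (m + n) = qpoch a q m * qpoch (a * q ^ m) q n"
  by (induction n) (simp_all add: qpoch_Suc power_add mult_ac)

lemma qpoch_tendsto:
  assumes "norm q < 1"
  shows "(\<lambda>n. qpoch a q n) \<longlonglongrightarrow> qpoch_inf a q"
    and "(\<And>m. a * q ^ m \<noteq> 1) \<Longrightarrow> qpoch_inf a q \<noteq> 0"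
proof -
  have "summable (\<lambda>m. norm ((1 - a * q ^ m) - 1))"
    using assms by (simp add: norm_mult norm_power summable_mult summable_geometric)
  hence conv: "convergent_prod (\<lambda>m. 1 - a * q ^ m)"
    by (intro abs_convergent_prod_imp_convergent_prod summable_imp_abs_convergent_prod)
  have "(\<lambda>n. \<Prod>i\<le>n. 1 - a * q ^ i) \<longlonglongrightarrow> qpoch_inf a q"
    unfolding qpoch_inf_def by (rule convergent_prod_LIMSEQ[OF conv])
  thus "(\<lambda>n. qpoch a q n) \<longlonglongrightarrow> qpoch_inf a q"
    unfolding qpoch_def by (simp add: LIMSEQ_lessThan_iff_atMost)
  show "qpoch_inf a q \<noteq> 0" if "\<And>m. a * q ^ m \<noteq> 1"
    unfolding qpoch_inf_def using that by (intro prodinf_nonzero[OF conv]) auto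
qed

lemma qpoch_inf_split:
  assumes "norm q < 1"
  shows "qpoch_inf a q = qpoch a q n * qpoch_inf (a * q ^ n) q"
proof -
  have "(\<lambda>k. qpoch a q (n + k)) \<longlonglongrightarrow> qpoch_inf a q"
    using LIMSEQ_ignore_initial_segment[OF qpoch_tendsto(1)[OF assms], of a n] by (simp add: add_ac)
  moreover have "(\<lambda>k. qpoch a q (n + k)) \<longlonglongrightarrow> qpoch a q n * qpoch_inf (a * q ^ n) q"
    unfolding qpoch_add by (intro tendsto_intros qpoch_tendsto assms)
  ultimately show ?thesis by (rule LIMSEQ_unique)
qed

lemma power_neq_1:
  fixes q :: complex
  assumes "norm q < 1" "n > 0"
  shows "q ^ n \<noteq> 1"
proof
  assume "q ^ n = 1"
  hence "norm q ^ n = 1" by (metis norm_one norm_power)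
  moreover have "norm q ^ n < 1 ^ n" using assms by (intro power_strict_mono) auto
  ultimately show False by simp
qed

lemma qpoch_nonzero:
  assumes "norm q < 1"
  shows "qpoch q q n \<noteq> 0"
  using power_neq_1[OF assms, of "Suc _"] by (simp add: qpoch_def)

lemma qpoch_inf_nonzero:
  assumes "norm q < 1"
  shows "qpoch_inf q q \<noteq> 0"
  using power_neq_1[OF assms, of "Suc _"] by (intro qpoch_tendsto(2) assms) simp

text \<open>
  The value 0 at negative arguments is the usual convention for \<open>1 / (q;q)\<close> with a negative index.
  It lets every sum below run over an index range wider than its support, so that shifts and
  reflections of the summation index need no boundary terms.
\<close>
definition qfact_inv :: "complex \<Rightarrow> int \<Rightarrow> complex" where
  "qfact_inv q n = (if n < 0 then 0 else 1 / qpoch q q (nat n))"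

lemma qfact_inv_of_nat [simp]: "qfact_inv q (int n) = 1 / qpoch q q n"
  by (simp add: qfact_inv_def)

lemma qfact_inv_neg [simp]: "n < 0 \<Longrightarrow> qfact_inv q n = 0"
  by (simp add: qfact_inv_def)

lemma qfact_inv_0 [simp]: "qfact_inv q 0 = 1"
  by (simp add: qfact_inv_def)

text \<open>
  At \<open>n = 0\<close> both sides vanish, which is why the recurrence survives for all integers.
  With the value 1 at 0 it determines \<open>qfact_inv\<close>, and the finite identities below rest on it.
\<close>
lemma qfact_inv_rec:
  assumes "norm q < 1"
  shows "(1 - q powi n) * qfact_inv q n = qfact_inv q (n - 1)"
proof (cases "n \<ge> 1")
  case True
  then obtain m where n: "n = int (Suc m)"
    by (intro that[of "nat (n - 1)"]) simp
  have "1 - q ^ Suc m \<noteq> 0" using power_neq_1[OF assms, of "Suc m"] by auto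
  hence "(1 - q ^ Suc m) * (1 / (qpoch q q m * (1 - q ^ Suc m))) = 1 / qpoch q q m"
    by (simp add: divide_simps)
  moreover have "qfact_inv q n = 1 / (qpoch q q m * (1 - q ^ Suc m))"
    unfolding n qfact_inv_of_nat by (simp add: qpoch_Suc)
  moreover have "n - 1 = int m" "q powi n = q ^ Suc m" unfolding n by (simp, rule power_int_of_nat)
  ultimately show ?thesis by (metis qfact_inv_of_nat)
next
  case False
  thus ?thesis by (cases "n = 0") (auto simp: qfact_inv_def)
qed

lemma qfact_inv_tendsto:
  assumes "norm q < 1"
  shows "(\<lambda>n. qfact_inv q (int n + t)) \<longlonglongrightarrow> 1 / qpoch_inf q q"
proof -
  have "(\<lambda>n. 1 / qpoch q q n) \<longlonglongrightarrow> 1 / qpoch_inf q q"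
    by (intro tendsto_intros qpoch_tendsto qpoch_inf_nonzero assms)
  hence "(\<lambda>n. qfact_inv q (int (n + nat t))) \<longlonglongrightarrow> 1 / qpoch_inf q q"
    unfolding qfact_inv_of_nat by (rule LIMSEQ_ignore_initial_segment)
  hence "(\<lambda>n. qfact_inv q (int (n + nat (-t)) + t)) \<longlonglongrightarrow> 1 / qpoch_inf q q"
    by (rule Lim_transform_eventually) (auto intro!: always_eventually arg_cong[of _ _ "qfact_inv q"])
  thus ?thesis by (rule LIMSEQ_offset)
qed

lemma qfact_inv_bounded:
  assumes "norm q < 1"
  obtains C where "C \<ge> 1" "\<And>n. norm (qfact_inv q n) \<le> C"
proof -
  have "Bseq (\<lambda>n. qfact_inv q (int n))"
    using qfact_inv_tendsto[OF assms, of 0] by (auto intro: convergent_imp_Bseq convergentI)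
  then obtain C where C: "\<And>n. norm (qfact_inv q (int n)) \<le> C"
    by (auto simp: Bseq_def simp del: qfact_inv_of_nat)
  have C1: "1 \<le> C" using C[of 0] by (simp del: qfact_inv_of_nat)
  have "norm (qfact_inv q n) \<le> C" for n
  proof (cases "n < 0")
    case False
    thus ?thesis using C[of "nat n"] by (simp del: qfact_inv_of_nat)
  qed (use C1 in simp)
  with C1 that show ?thesis by blast
qed

section \<open>The q-Vandermonde sum and its limit\<close>

text \<open>
  Splitting \<open>1 - q^M = (1 - q^(M-m)) + q^(M-m) (1 - q^m)\<close> inside the sum \<open>V(M,t)\<close> gives
  \<open>(1 - q^M) V(M,t) = V(M-1,t) + q^(M+t) V(M-1,t+1)\<close>, and the product on the right satisfies the
  same recurrence. The shift of \<open>t\<close> forces \<open>t\<close> to be an arbitrary integer in the induction.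
\<close>
lemma qVandermonde:
  assumes q: "norm q < 1" "q \<noteq> 0"
  shows "(\<Sum>m=0..int M. q powi (m * (m + t)) * qfact_inv q (int M - m) * qfact_inv q m * qfact_inv q (m + t))
           = qfact_inv q (int M) * qfact_inv q (int M + t)"
proof (induction M arbitrary: t)
  case 0
  show ?case by simp
next
  case (Suc M)
  let ?r = "qfact_inv q"
  define N where "N = int (Suc M)"
  have N: "int M = N - 1" "N > 0" by (auto simp: N_def)
  note IH = Suc.IH[unfolded N]
  let ?S = "\<lambda>N t. (\<Sum>m=0..N. q powi (m * (m + t)) * ?r (N - m) * ?r m * ?r (m + t))"
  have nz: "1 - q powi N \<noteq> 0"
    using power_neq_1[OF q(1), of "Suc M"] unfolding N_def power_int_of_nat by auto
  have "(1 - q powi N) * ?S N t = 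
     (\<Sum>m=0..N. q powi (m * (m + t)) * ?r (N - 1 - m) * ?r m * ?r (m + t))
     + (\<Sum>m=0..N. q powi (N + m * (m + t) - m) * ?r (N - m) * ?r (m - 1) * ?r (m + t))"
    unfolding sum_distrib_left sum.distrib [symmetric]
  proof (rule sum.cong)
    fix m
    have e: "q powi N = q powi (N - m) * q powi m" "q powi (N + m * (m + t) - m) = q powi (m * (m + t)) * q powi (N - m)"
      using q by (simp_all flip: power_int_add add: algebra_simps)
    have r: "?r (N - 1 - m) = (1 - q powi (N - m)) * ?r (N - m)" "?r (m - 1) = (1 - q powi m) * ?r m"
      using qfact_inv_rec[OF q(1), of "N - m"] qfact_inv_rec[OF q(1), of m] by (simp_all add: algebra_simps)
    show "(1 - q powi N) * (q powi (m * (m + t)) * ?r (N - m) * ?r m * ?r (m + t)) =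
         q powi (m * (m + t)) * ?r (N - 1 - m) * ?r m * ?r (m + t) +
         q powi (N + m * (m + t) - m) * ?r (N - m) * ?r (m - 1) * ?r (m + t)"
      unfolding r e by (simp add: algebra_simps)
  qed simp
  also have "(\<Sum>m=0..N. q powi (m * (m + t)) * ?r (N - 1 - m) * ?r m * ?r (m + t)) = ?S (N - 1) t"
    by (rule sum.mono_neutral_right) auto
  also have "(\<Sum>m=0..N. q powi (N + m * (m + t) - m) * ?r (N - m) * ?r (m - 1) * ?r (m + t))
     = (\<Sum>m=1..N. q powi (N + m * (m + t) - m) * ?r (N - m) * ?r (m - 1) * ?r (m + t))"
    by (rule sum.mono_neutral_right) auto
  also have "\<dots> = q powi (N + t) * ?S (N - 1) (t + 1)"
    unfolding sum_distrib_left
    by (rule sum.reindex_bij_witness[of _ "\<lambda>m. m + 1" "\<lambda>m. m - 1"])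
       (use q in \<open>auto simp: algebra_simps simp flip: power_int_add\<close>)
  also have "?S (N - 1) t = ?r (N - 1) * ?r (N + t - 1)" using IH[of t] by (simp add: algebra_simps)
  also have "?S (N - 1) (t + 1) = ?r (N - 1) * ?r (N + t)" using IH[of "t + 1"] by (simp add: algebra_simps)
  also have "?r (N + t - 1) = (1 - q powi (N + t)) * ?r (N + t)" using qfact_inv_rec[OF q(1), of "N + t"] by simp
  also have "?r (N - 1) * ((1 - q powi (N + t)) * ?r (N + t)) + q powi (N + t) * (?r (N - 1) * ?r (N + t))
     = ?r (N - 1) * ?r (N + t)" by (simp add: algebra_simps)
  also have "\<dots> = (1 - q powi N) * (?r N * ?r (N + t))" using qfact_inv_rec[OF q(1), of N] by simp
  finally show ?case using nz unfolding N_def[symmetric] by simp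
qed

lemma has_sum_int_iff_nat:
  fixes f :: "int \<Rightarrow> complex"
  assumes "\<And>n. n < 0 \<Longrightarrow> f n = 0"
  shows "(f has_sum S) UNIV \<longleftrightarrow> ((\<lambda>n. f (int n)) has_sum S) UNIV"
proof -
  have "(f has_sum S) UNIV \<longleftrightarrow> (f has_sum S) (range int)"
  proof (rule has_sum_cong_neutral)
    fix n assume "n \<in> UNIV - range int"
    hence "n < 0" by (metis DiffD2 nonneg_int_cases not_less rangeI)
    thus "f n = 0" by (rule assms)
  qed auto
  also have "\<dots> \<longleftrightarrow> ((\<lambda>n. f (int n)) has_sum S) UNIV"
    by (subst has_sum_reindex) (auto simp: o_def)
  finally show ?thesis .
qed

lemma abs_summable_on_Times:
  fixes f :: "'a \<Rightarrow> 'c :: real_normed_field" and g :: "'b \<Rightarrow> 'c"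
  assumes "f abs_summable_on A" "g abs_summable_on B"
  shows "(\<lambda>(x, y). f x * g y) abs_summable_on A \<times> B"
proof (rule summable_on_SigmaI)
  show "((\<lambda>y. norm (case (x, y) of (x, y) \<Rightarrow> f x * g y)) has_sum norm (f x) * infsum (\<lambda>y. norm (g y)) B) B" for x
    by (simp add: norm_mult) (intro has_sum_cmult_right has_sum_infsum assms)
  show "(\<lambda>x. norm (f x) * infsum (\<lambda>y. norm (g y)) B) summable_on A"
    by (intro summable_on_cmult_left assms)
qed auto

lemma has_sum_Times:
  fixes f :: "'a \<Rightarrow> complex" and g :: "'b \<Rightarrow> complex"
  assumes "(f has_sum a) A" "(g has_sum b) B"
  shows "((\<lambda>(x, y). f x * g y) has_sum (a * b)) (A \<times> B)"
proof (rule has_sum_SigmaI)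
  show "((\<lambda>y. case (x, y) of (x, y) \<Rightarrow> f x * g y) has_sum f x * b) B" for x
    by simp (intro has_sum_cmult_right assms)
  show "((\<lambda>x. f x * b) has_sum a * b) A"
    by (intro has_sum_cmult_left assms)
  show "(\<lambda>(x, y). f x * g y) summable_on A \<times> B"
    using assms[THEN has_sum_imp_summable]
    unfolding summable_on_iff_abs_summable_on_complex by (rule abs_summable_on_Times)
qed

text \<open>
  Let \<open>M\<close> tend to infinity in \<open>qVandermonde\<close>, using Tannery's theorem: the factor
  \<open>1 / (q;q)_(M-m)\<close> and the right-hand side converge to one and two factors
  \<open>1 / (q;q)_\<infinity>\<close> respectively. For \<open>t \<ge> 0\<close> this is the dissection of partitions by
  Durfee rectangles; negative \<open>t\<close> is needed as well because \<open>t\<close> becomes a bilateral summation index.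
\<close>
lemma durfee_rectangle:
  assumes q: "norm q < 1" "q \<noteq> 0"
  shows "((\<lambda>m. q powi (m * (m + t)) * qfact_inv q m * qfact_inv q (m + t))
            has_sum (1 / qpoch_inf q q)) UNIV"
proof -
  let ?r = "qfact_inv q"
  define P where "P = qpoch_inf q q"
  have P: "P \<noteq> 0" unfolding P_def by (rule qpoch_inf_nonzero[OF q(1)])
  obtain C where C: "C \<ge> 1" "\<And>n. norm (?r n) \<le> C"
    using qfact_inv_bounded[OF q(1)] by blast
  define a where "a = (\<lambda>m n. q powi (int m * (int m + t)) * ?r (int n - int m) * ?r (int m) * ?r (int m + t))"
  define b where "b = (\<lambda>m. q powi (int m * (int m + t)) * (1 / P) * ?r (int m) * ?r (int m + t))"
  define M where "M = (\<lambda>m. norm q powi (- \<bar>t\<bar>) * C * C * C * norm q ^ m)"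
  have bound: "norm (a m n) \<le> M m" for m n
  proof (cases "int m + t < 0")
    case False
    \<comment> \<open>The term vanishes for m + t < 0; elsewhere this linear bound on the exponent makes the
      majorant geometric, uniformly in n.\<close>
    have "int m - \<bar>t\<bar> \<le> int m * (int m + t)"
    proof (cases "m = 0")
      case False
      have "int m - \<bar>t\<bar> \<le> 1 * (int m + t)" by arith
      also have "\<dots> \<le> int m * (int m + t)"
        using False \<open>\<not> int m + t < 0\<close> by (intro mult_right_mono) auto
      finally show ?thesis .
    qed simp
    hence "norm q powi (int m * (int m + t)) \<le> norm q powi (int m - \<bar>t\<bar>)"
      using q by (intro power_int_decreasing) auto
    also have "\<dots> = norm q powi (-\<bar>t\<bar>) * norm q ^ m"
      using q by (simp flip: power_int_of_nat power_int_add)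
    finally have "norm (a m n) \<le> (norm q powi (-\<bar>t\<bar>) * norm q ^ m) * C * C * C"
      unfolding a_def norm_mult norm_power_int using C
      by (intro mult_mono mult_nonneg_nonneg norm_ge_zero) (auto simp del: qfact_inv_of_nat)
    thus ?thesis by (simp add: M_def mult_ac)
  qed (use C in \<open>simp add: a_def M_def\<close>)
  have lim: "a m \<longlonglongrightarrow> b m" for m
    using qfact_inv_tendsto[OF q(1), of "- int m"]
    unfolding a_def b_def P_def by (intro tendsto_intros) auto
  have T: "summable (\<lambda>m. norm (b m)) \<and> (\<lambda>n. \<Sum>m. a m n) \<longlonglongrightarrow> (\<Sum>m. b m)"
  proof (rule conjunct2[OF tannerys_theorem])
    show "summable M" unfolding M_def using q by (intro summable_mult summable_geometric) auto
    show "\<forall>\<^sub>F (k, n) in sequentially \<times>\<^sub>F sequentially. norm (a k n) \<le> M k"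
      by (intro always_eventually) (auto intro: bound)
  qed (use lim in auto)
  have "(\<Sum>m. a m n) = ?r (int n) * ?r (int n + t)" for n
  proof -
    have "(\<Sum>m. a m n) = (\<Sum>m\<le>n. a m n)"
      by (rule suminf_finite) (auto simp: a_def)
    also have "\<dots> = (\<Sum>m=0..int n. q powi (m * (m + t)) * ?r (int n - m) * ?r m * ?r (m + t))"
      unfolding a_def by (rule sum.reindex_bij_witness[of _ nat int]) auto
    also note qVandermonde[OF q]
    finally show ?thesis .
  qed
  hence "(\<lambda>n. ?r (int n) * ?r (int n + t)) \<longlonglongrightarrow> (\<Sum>m. b m)" using T by simp
  moreover have "(\<lambda>n. ?r (int n) * ?r (int n + t)) \<longlonglongrightarrow> 1 / P * (1 / P)"
    using qfact_inv_tendsto[OF q(1), of 0] qfact_inv_tendsto[OF q(1), of t]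
    unfolding P_def by (intro tendsto_mult) auto
  ultimately have "(\<Sum>m. b m) = 1 / P * (1 / P)" by (rule LIMSEQ_unique)
  hence "(b has_sum (1 / P * (1 / P))) UNIV"
    using T by (metis norm_summable_imp_has_sum summable_norm_cancel summable_sums)
  hence "((\<lambda>m. P * b m) has_sum (P * (1 / P * (1 / P)))) UNIV"
    by (rule has_sum_cmult_right)
  also have "(\<lambda>m. P * b m) = (\<lambda>m. q powi (int m * (int m + t)) * ?r (int m) * ?r (int m + t))"
    using P by (simp add: b_def fun_eq_iff)
  also have "P * (1 / P * (1 / P)) = 1 / P" using P by simp
  finally show ?thesis
    by (subst has_sum_int_iff_nat) (auto simp: P_def)
qed

section \<open>Euler's expansion and the Jacobi triple product\<close>

text \<open>
  The left-hand side is an entire power series \<open>E(x)\<close> with \<open>E(x) = (1 + x) E(q x)\<close>. Iterating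
  this and using continuity at 0 with \<open>E(0) = 1\<close> produces the infinite product.
\<close>
lemma euler_qexp:
  assumes q: "norm q < 1"
  shows "((\<lambda>i. q ^ (i * (i - 1) div 2) * x ^ i / qpoch q q i) has_sum qpoch_inf (-x) q) UNIV"
proof -
  define c where "c = (\<lambda>i. q ^ (i * (i - 1) div 2) / qpoch q q i)"
  have nz: "1 - q ^ Suc n \<noteq> 0" for n using power_neq_1[OF q, of "Suc n"] by auto
  have c_Suc: "c (Suc n) = c n * (q ^ n / (1 - q ^ Suc n))" for n
  proof -
    have "Suc n * (Suc n - 1) div 2 = n * (n - 1) div 2 + n"
      by (cases n) auto
    thus ?thesis by (simp add: c_def qpoch_Suc power_add)
  qed
  have summ: "summable (\<lambda>n. norm (c n * x ^ n))" for x
  proof -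
    have "(\<lambda>n. q ^ n / (1 - q ^ Suc n) * x) \<longlonglongrightarrow> 0 / (1 - 0) * x"
      by (intro tendsto_intros LIMSEQ_power_zero LIMSEQ_Suc q) auto
    hence "(\<lambda>n. norm (q ^ n / (1 - q ^ Suc n) * x)) \<longlonglongrightarrow> 0"
      by (intro tendsto_norm_zero) simp
    hence "\<forall>\<^sub>F n in sequentially. norm (q ^ n / (1 - q ^ Suc n) * x) < 1/2"
      by (rule order_tendstoD) simp
    then obtain N where N: "\<And>n. n \<ge> N \<Longrightarrow> norm (q ^ n / (1 - q ^ Suc n) * x) < 1/2"
      by (auto simp: eventually_at_top_linorder)
    show ?thesis
    proof (rule summable_ratio_test[of "1/2" N])
      fix n assume "n \<ge> N"
      have "norm (c (Suc n) * x ^ Suc n) = norm (q ^ n / (1 - q ^ Suc n) * x) * norm (c n * x ^ n)"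
        by (simp only: c_Suc norm_mult [symmetric] power_Suc) (simp only: mult_ac)
      also have "\<dots> \<le> 1/2 * norm (c n * x ^ n)"
        using N[OF \<open>n \<ge> N\<close>] by (intro mult_right_mono) auto
      finally show "norm (norm (c (Suc n) * x ^ Suc n)) \<le> 1/2 * norm (norm (c n * x ^ n))" by simp
    qed simp
  qed
  define E where "E = (\<lambda>x. \<Sum>n. c n * x ^ n)"
  have E: "(\<lambda>n. c n * x ^ n) sums E x" for x
    unfolding E_def by (rule summable_sums[OF summable_norm_cancel[OF summ]])
  have E_rec: "E x = (1 + x) * E (x * q)" for x
  proof -
    have "(\<lambda>n. c n * x ^ n - c n * (x * q) ^ n) sums (E x - E (x * q))"
      by (intro sums_diff E)
    hence "(\<lambda>n. c (Suc n) * x ^ Suc n - c (Suc n) * (x * q) ^ Suc n) sums (E x - E (x * q))"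
      by (subst sums_Suc_iff) simp
    also have "(\<lambda>n. c (Suc n) * x ^ Suc n - c (Suc n) * (x * q) ^ Suc n) = (\<lambda>n. x * (c n * (x * q) ^ n))"
    proof
      fix n
      have "c (Suc n) * x ^ Suc n - c (Suc n) * (x * q) ^ Suc n = c (Suc n) * (1 - q ^ Suc n) * x ^ Suc n"
        by (simp add: power_mult_distrib algebra_simps)
      also have "c (Suc n) * (1 - q ^ Suc n) = c n * q ^ n"
        unfolding c_Suc using nz[of n] by simp
      finally show "c (Suc n) * x ^ Suc n - c (Suc n) * (x * q) ^ Suc n = x * (c n * (x * q) ^ n)"
        by (simp add: power_mult_distrib mult_ac)
    qed
    finally have "(\<lambda>n. x * (c n * (x * q) ^ n)) sums (E x - E (x * q))" .
    moreover have "(\<lambda>n. x * (c n * (x * q) ^ n)) sums (x * E (x * q))"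
      by (intro sums_mult E)
    ultimately have "E x - E (x * q) = x * E (x * q)" by (rule sums_unique2)
    thus ?thesis by (simp add: algebra_simps)
  qed
  have E_n: "E x = qpoch (-x) q n * E (x * q ^ n)" for n
  proof (induction n)
    case (Suc n)
    thus ?case using E_rec[of "x * q ^ n"] by (simp add: qpoch_Suc mult_ac)
  qed simp
  have "isCont E 0"
    unfolding E_def by (rule isCont_powser[of _ 1]) (use summable_norm_cancel[OF summ[of 1]] in auto)
  moreover have "(\<lambda>n. x * q ^ n) \<longlonglongrightarrow> 0"
    by (intro tendsto_mult_right_zero LIMSEQ_power_zero q)
  ultimately have "(\<lambda>n. E (x * q ^ n)) \<longlonglongrightarrow> E 0"
    by (rule isCont_tendsto_compose)
  moreover have "E 0 = 1" unfolding E_def powser_zero by (simp add: c_def)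
  ultimately have "(\<lambda>n. qpoch (-x) q n * E (x * q ^ n)) \<longlonglongrightarrow> qpoch_inf (-x) q * 1"
    by (intro tendsto_mult qpoch_tendsto q) auto
  hence "(\<lambda>n. E x) \<longlonglongrightarrow> qpoch_inf (-x) q" by (simp flip: E_n)
  hence "E x = qpoch_inf (-x) q" by (simp add: LIMSEQ_const_iff)
  hence "((\<lambda>n. c n * x ^ n) has_sum qpoch_inf (-x) q) UNIV"
    using E[of x] summ[of x] by (intro norm_summable_imp_has_sum) auto
  thus ?thesis by (simp add: c_def)
qed

lemma twice_triangle: "2 * (t * (t - 1) div 2) = t * (t - (1::int))"
  by simp

text \<open>
  The bilateral form, whose terms of negative index vanish, so that a product of two such sums
  can be reindexed by arbitrary shifts.
\<close>
lemma euler_qexp_int: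
  assumes q: "norm q < 1"
  shows "((\<lambda>i. q powi (i * (i - 1) div 2) * x powi i * qfact_inv q i) has_sum qpoch_inf (-x) q) UNIV"
proof (subst has_sum_int_iff_nat)
  have "q powi (int i * (int i - 1) div 2) = q ^ (i * (i - 1) div 2)" for i
  proof -
    have "int i * (int i - 1) div 2 = int (i * (i - 1) div 2)"
      by (cases i) (auto simp: zdiv_int algebra_simps)
    thus ?thesis by (metis power_int_of_nat)
  qed
  thus "((\<lambda>n. q powi (int n * (int n - 1) div 2) * x powi int n * qfact_inv q (int n)) has_sum qpoch_inf (-x) q) UNIV"
    using euler_qexp[OF q, of x] by simp
qed auto

text \<open>
  Multiply Euler's expansions of \<open>(-x;q)_\<infinity>\<close> and \<open>(-q/x;q)_\<infinity>\<close> and collect the terms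
  with index pair \<open>(j + t, j)\<close>, which carry \<open>x^t\<close>. The exponent of \<open>q\<close> becomes
  \<open>t(t-1)/2 + j(j+t)\<close>, so the sum over \<open>j\<close> is that of \<open>durfee_rectangle\<close> and contributes the
  factor \<open>1 / (q;q)_\<infinity>\<close>.
\<close>
lemma jacobi_triple:
  assumes q: "norm q < 1" "q \<noteq> 0" and x: "x \<noteq> 0"
  shows "((\<lambda>t. q powi (t * (t - 1) div 2) * x powi t)
           has_sum (qpoch_inf q q * qpoch_inf (-x) q * qpoch_inf (-(q / x)) q)) UNIV"
proof -
  let ?r = "qfact_inv q"
  define P where "P = qpoch_inf q q"
  have P: "P \<noteq> 0" unfolding P_def by (rule qpoch_inf_nonzero[OF q(1)])
  define u where "u = (\<lambda>y i. q powi (i * (i - 1) div 2) * y powi i * ?r i)"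
  have "((\<lambda>(i, j). u x i * u (q / x) j) has_sum (qpoch_inf (-x) q * qpoch_inf (-(q / x)) q)) (UNIV \<times> UNIV)"
    unfolding u_def by (intro has_sum_Times euler_qexp_int q)
  hence "((\<lambda>(t, j). u x (j + t) * u (q / x) j) has_sum (qpoch_inf (-x) q * qpoch_inf (-(q / x)) q)) (UNIV \<times> UNIV)"
    by (subst has_sum_reindex_bij_witness[where i = "\<lambda>(i, j). (i - j, j)" and j = "\<lambda>(t, j). (j + t, j)"]) auto
  moreover have "((\<lambda>j. case (t, j) of (t, j) \<Rightarrow> u x (j + t) * u (q / x) j)
      has_sum (q powi (t * (t - 1) div 2) * x powi t * (1 / P))) UNIV" for t
  proof -
    have "u x (j + t) * u (q / x) j = q powi (t * (t - 1) div 2) * x powi t * (q powi (j * (j + t)) * ?r j * ?r (j + t))" for j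
    proof -
      have "2 * ((j + t) * (j + t - 1) div 2 + j * (j - 1) div 2 + j) = 2 * (t * (t - 1) div 2 + j * (j + t))"
        unfolding distrib_left twice_triangle by (simp add: algebra_simps)
      hence e: "(j + t) * (j + t - 1) div 2 + j * (j - 1) div 2 + j = t * (t - 1) div 2 + j * (j + t)" by simp
      have "u x (j + t) * u (q / x) j = q powi ((j + t) * (j + t - 1) div 2 + j * (j - 1) div 2 + j) * (x powi (j + t) / x powi j) * ?r j * ?r (j + t)"
        using q by (simp add: u_def power_int_add power_int_divide_distrib)
      also have "x powi (j + t) / x powi j = x powi t" using x by (simp add: power_int_add)
      finally show ?thesis unfolding e using q by (simp add: power_int_add mult_ac)
    qed
    thus ?thesis
      using has_sum_cmult_right[OF durfee_rectangle[OF q, of t], of "q powi (t * (t - 1) div 2) * x powi t"]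
      by (simp add: P_def)
  qed
  ultimately have "((\<lambda>t. q powi (t * (t - 1) div 2) * x powi t * (1 / P)) has_sum (qpoch_inf (-x) q * qpoch_inf (-(q / x)) q)) UNIV"
    by (rule has_sum_SigmaD)
  from has_sum_cmult_left[OF this, of P] show ?thesis using P by (simp add: P_def mult_ac)
qed

section \<open>Two Bailey pairs with common coefficients\<close>

text \<open>
  The terms of the pentagonal number series. They serve for two Bailey pairs at once and are deliberately not symmetrised
  in \<open>r\<close>: the same sequence, indexed by all integers, works relative to \<open>a = 1\<close> and to
  \<open>a = q^2\<close>, and this coincidence is what collapses the two halves of the triple sum into one.
\<close>
definition theta_coeff :: "complex \<Rightarrow> int \<Rightarrow> complex" where
  "theta_coeff q r = (-1) powi r * q powi (r * (3 * r + 1) div 2)"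

lemma twice_pentagonal: "2 * (r * (3 * r + 1) div 2) = r * (3 * r + (1::int))"
  by simp

lemma minus_one_powi_reflect:
  "(-1) powi (- r) = ((-1) powi r :: complex)"
  by (simp add: power_int_minus flip: power_int_inverse)

lemma theta_coeff_0 [simp]: "theta_coeff q 0 = 1"
  by (simp add: theta_coeff_def)

lemma power2_powi: "(q ^ 2 :: complex) powi n = q powi (2 * n)"
  by (simp add: power_int_power)

lemma theta_coeff_reflect_neg:
  assumes "q \<noteq> 0"
  shows "theta_coeff q (- r - 1) * (q^2) powi (- r - 1) = - theta_coeff q r / q"
proof -
  have "2 * ((- r - 1) * (3 * (- r - 1) + 1) div 2 + 2 * (- r - 1)) = 2 * (r * (3 * r + 1) div 2 - 1)"
    unfolding distrib_left right_diff_distrib twice_pentagonal by (simp add: algebra_simps)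
  hence e: "(- r - 1) * (3 * (- r - 1) + 1) div 2 + 2 * (- r - 1) = r * (3 * r + 1) div 2 - 1" by simp
  have "theta_coeff q (- r - 1) * (q^2) powi (- r - 1)
     = (-1) powi (- r - 1) * q powi ((- r - 1) * (3 * (- r - 1) + 1) div 2 + 2 * (- r - 1))"
    unfolding theta_coeff_def power2_powi by (subst power_int_add) (use assms in simp, simp only: mult_ac)
  also have "(-1) powi (- r - 1) = - ((-1) powi r :: complex)"
    using minus_one_powi_reflect[of r] by (simp add: power_int_diff)
  also note e
  also have "(- ((-1) powi r)) * q powi (r * (3 * r + 1) div 2 - 1) = - theta_coeff q r / q"
    using assms by (simp add: theta_coeff_def power_int_diff)
  finally show ?thesis .
qed

lemma theta_coeff_reflect_one_minus:
  assumes "q \<noteq> 0"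
  shows "theta_coeff q (1 - r) * (q^2) powi (- (1 - r)) = - (theta_coeff q r * (q^2) powi (- r))"
proof -
  have "2 * ((1 - r) * (3 * (1 - r) + 1) div 2 + 2 * (- (1 - r))) = 2 * (r * (3 * r + 1) div 2 + 2 * (- r))"
    unfolding distrib_left twice_pentagonal by (simp add: algebra_simps)
  hence e: "(1 - r) * (3 * (1 - r) + 1) div 2 + 2 * (- (1 - r)) = r * (3 * r + 1) div 2 + 2 * (- r)" by simp
  have *: "theta_coeff q s * (q^2) powi (- s) = (-1) powi s * q powi (s * (3 * s + 1) div 2 + 2 * (- s))" for s
    unfolding theta_coeff_def power2_powi by (subst power_int_add) (use assms in simp, simp only: mult_ac)
  have "(-1) powi (1 + (- r)) = - ((-1) powi r :: complex)"
    by (subst power_int_add) (simp_all only: minus_one_powi_reflect, simp_all)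
  thus ?thesis unfolding * e by simp
qed

text \<open>
  Write \<open>1 / (Q;Q)_(k+r)\<close> as \<open>(1 - Q^(k+r+1)) / (Q;Q)_(k+r+1)\<close> with \<open>Q = q^2\<close>. The part
  without \<open>Q^r\<close> is already the sum on the right; in the other part the reflection
  \<open>r \<mapsto> -r-1\<close> fixes the denominators, and \<open>theta_coeff_reflect_neg\<close> turns that part into a
  multiple of the same sum.
\<close>
lemma bailey_sum_descent:
  fixes k :: int
  assumes q: "norm q < 1" "q \<noteq> 0"
  defines "\<rho> \<equiv> qfact_inv (q^2)"
  shows "(\<Sum>r=-k-1..k. theta_coeff q r * \<rho> (k - r) * \<rho> (k + r))
           = (1 + q powi (2 * k + 1)) * (\<Sum>r=-k-1..k. theta_coeff q r * \<rho> (k - r) * \<rho> (k + r + 1))"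
    (is "?F = _ * ?G")
proof -
  have q2: "norm (q^2) < 1" using q by (simp add: norm_power power_less_one_iff abs_square_less_1)
  define H where "H = (\<Sum>r=-k-1..k. theta_coeff q r * (q^2) powi r * \<rho> (k - r) * \<rho> (k + r + 1))"
  have "?F = (\<Sum>r=-k-1..k. theta_coeff q r * \<rho> (k - r) * ((1 - (q^2) powi (k + r + 1)) * \<rho> (k + r + 1)))"
    unfolding \<rho>_def qfact_inv_rec[OF q2] by simp
  also have "\<dots> = ?G - (q^2) powi (k + 1) * H"
    unfolding H_def sum_distrib_left sum_subtractf [symmetric]
    using q by (intro sum.cong) (auto simp: algebra_simps power_int_add)
  also have "H = (\<Sum>r=-k-1..k. theta_coeff q (- r - 1) * (q^2) powi (- r - 1) * \<rho> (k - r) * \<rho> (k + r + 1))"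
    unfolding H_def by (rule sum.reindex_bij_witness[of _ "\<lambda>r. - r - 1" "\<lambda>r. - r - 1"]) (auto simp: algebra_simps)
  also have "\<dots> = - (1 / q) * ?G"
    unfolding theta_coeff_reflect_neg[OF q(2)] sum_distrib_left by (intro sum.cong) auto
  also have "?G - (q^2) powi (k + 1) * (- (1 / q) * ?G) = (1 + q powi (2 * k + 1)) * ?G"
    unfolding power2_powi using q by (simp add: power_int_add field_simps power2_eq_square)
  finally show ?thesis .
qed

text \<open>
  With \<open>Q = q^2\<close>, split \<open>1 - Q^(2k+2) = (1 - Q^(k+1-r)) + Q^(k+1-r) (1 - Q^(k+1+r))\<close>. The first
  part gives the right-hand side. In the second part the reflection \<open>r \<mapsto> 1-r\<close> exchanges the two
  denominators while \<open>theta_coeff_reflect_one_minus\<close> changes the sign, so it cancels.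
\<close>
lemma bailey_sum_ascent:
  fixes k :: int
  assumes q: "norm q < 1" "q \<noteq> 0"
  defines "\<rho> \<equiv> qfact_inv (q^2)"
  shows "(1 - q powi (4 * k + 4)) * (\<Sum>r=-(k+1)-1..k+1. theta_coeff q r * \<rho> (k + 1 - r) * \<rho> (k + 1 + r))
           = (\<Sum>r=-k-1..k. theta_coeff q r * \<rho> (k - r) * \<rho> (k + r + 1))"
    (is "_ * sum ?f ?A = ?G")
proof -
  have q2: "norm (q^2) < 1" using q by (simp add: norm_power power_less_one_iff abs_square_less_1)
  define W where "W = (\<lambda>r. theta_coeff q r * (q^2) powi (- r) * \<rho> (k + 1 - r) * \<rho> (k + r))"
  have "(1 - q powi (4 * k + 4)) * sum ?f ?A
      = (\<Sum>r\<in>?A. theta_coeff q r * \<rho> (k - r) * \<rho> (k + r + 1)) + (q^2) powi (k + 1) * sum W ?A"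
    unfolding sum_distrib_left sum.distrib [symmetric]
  proof (rule sum.cong)
    fix r
    have e: "q powi (4 * k + 4) = (q^2) powi (k + 1 - r) * (q^2) powi (k + 1 + r)"
      unfolding power2_powi using q by (simp flip: power_int_add)
    have e': "(q^2) powi (k + 1) * (q^2) powi (- r) = (q^2) powi (k + 1 - r)"
      using q by (simp flip: power_int_add)
    have r: "\<rho> (k - r) = (1 - (q^2) powi (k + 1 - r)) * \<rho> (k + 1 - r)"
            "\<rho> (k + r) = (1 - (q^2) powi (k + 1 + r)) * \<rho> (k + 1 + r)"
      unfolding \<rho>_def qfact_inv_rec[OF q2] by (simp_all add: algebra_simps)
    have "(q^2) powi (k + 1) * W r = (q^2) powi (k + 1 - r) * theta_coeff q r * \<rho> (k + 1 - r) * \<rho> (k + r)"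
      unfolding e'[symmetric] W_def by (simp add: mult_ac)
    thus "(1 - q powi (4 * k + 4)) * ?f r = theta_coeff q r * \<rho> (k - r) * \<rho> (k + r + 1) + (q^2) powi (k + 1) * W r"
      unfolding e by (simp add: r algebra_simps)
  qed simp
  also have "(\<Sum>r\<in>?A. theta_coeff q r * \<rho> (k - r) * \<rho> (k + r + 1)) = ?G"
    by (rule sum.mono_neutral_right) (auto simp: \<rho>_def qfact_inv_def)
  also have "sum W ?A = sum W {-k..k+1}"
    by (rule sum.mono_neutral_right) (auto simp: W_def \<rho>_def qfact_inv_def)
  also have "sum W {-k..k+1} = 0"
  proof -
    have "W (1 - r) = - W r" for r
      unfolding W_def theta_coeff_reflect_one_minus[OF q(2)] by (simp add: algebra_simps)
    moreover have "sum W {-k..k+1} = (\<Sum>r=-k..k+1. W (1 - r))"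
      by (rule sum.reindex_bij_witness[of _ "\<lambda>r. 1 - r" "\<lambda>r. 1 - r"]) auto
    ultimately have "sum W {-k..k+1} = - sum W {-k..k+1}" by (simp add: sum_negf)
    thus ?thesis by simp
  qed
  finally show ?thesis by simp
qed

lemma one_plus_power_nonzero:
  fixes q :: complex
  assumes "norm q < 1" "n > 0"
  shows "1 + q ^ n \<noteq> 0"
proof
  assume "1 + q ^ n = 0"
  hence "(q ^ n)^2 = 1" by (simp add: add_eq_0_iff)
  hence "q ^ (n * 2) = 1" by (simp add: power_mult)
  thus False using power_neq_1[OF assms(1), of "n * 2"] assms(2) by simp
qed

text \<open>
  The left-hand sides satisfy the same interlaced recurrences as the two sums in
  \<open>bailey_sum_descent\<close> and \<open>bailey_sum_ascent\<close>. These are pairs of Slater's, behind the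
  Rogers--Selberg identities of modulus 7.
\<close>
lemma bailey_pair:
  assumes q: "norm q < 1" "q \<noteq> 0"
  defines "\<rho> \<equiv> qfact_inv (q^2)"
  shows "1 / (qpoch (q^4) (q^4) k * qpoch (-q) (q^2) k)
           = (\<Sum>r=-int k-1..int k. theta_coeff q r * \<rho> (int k - r) * \<rho> (int k + r))" (is "?a k = ?F k")
    and "1 / (qpoch (q^4) (q^4) k * qpoch (-q) (q^2) (Suc k))
           = (\<Sum>r=-int k-1..int k. theta_coeff q r * \<rho> (int k - r) * \<rho> (int k + r + 1))" (is "?b k = ?G k")
proof -
  have FG: "?G k = ?F k / (1 + q ^ (2 * k + 1))" for k
  proof -
    have "q powi (2 * int k + 1) = q ^ (2 * k + 1)"
      unfolding power_int_of_nat [symmetric] by (simp add: add_ac)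
    hence "?F k = (1 + q ^ (2 * k + 1)) * ?G k"
      using bailey_sum_descent[OF q, of "int k"] unfolding \<rho>_def by simp
    thus ?thesis using one_plus_power_nonzero[OF q(1), of "2 * k + 1"] by simp
  qed
  have GF: "?F (Suc k) = ?G k / (1 - q ^ (4 * Suc k))" for k
  proof -
    have "q powi (4 * int k + 4) = q ^ (4 * Suc k)"
      unfolding power_int_of_nat [symmetric] by (simp add: algebra_simps)
    hence "(1 - q ^ (4 * Suc k)) * ?F (Suc k) = ?G k"
      using bailey_sum_ascent[OF q, of "int k"] unfolding \<rho>_def by (simp add: algebra_simps)
    moreover have "1 - q ^ (4 * Suc k) \<noteq> 0" using power_neq_1[OF q(1), of "4 * Suc k"] by auto
    ultimately show ?thesis by (simp add: field_simps)
  qed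
  have ab: "?b k = ?a k / (1 + q ^ (2 * k + 1))" for k
    by (simp add: qpoch_Suc mult_ac flip: power_mult)
  have ba: "?a (Suc k) = ?b k / (1 - q ^ (4 * Suc k))" for k
    by (simp add: qpoch_Suc mult_ac flip: power_mult power_add)
  have *: "?a k = ?F k" for k
  proof (induction k)
    case 0
    have "{-1..0::int} = {-1, 0}" by auto
    thus ?case by (simp add: \<rho>_def)
  next
    case (Suc k)
    thus ?case by (simp only: ba GF ab FG)
  qed
  show "?a k = ?F k" by (rule *)
  show "?b k = ?G k" by (simp only: ab FG *)
qed

text \<open>
  This is \<open>qVandermonde\<close> with \<open>m = k - r\<close>. The condition on \<open>r\<close> and \<open>s\<close> guarantees that the
  support \<open>k \<ge> max r (-s)\<close> contains no negative \<open>k\<close>.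
\<close>
lemma bailey_kernel:
  assumes q: "norm q < 1" "q \<noteq> 0" and rs: "0 \<le> r \<or> s \<le> 0"
  shows "(\<Sum>k\<le>n. q powi ((int k - r) * (int k + s)) * qfact_inv q (int n - int k)
             * qfact_inv q (int k - r) * qfact_inv q (int k + s))
           = qfact_inv q (int n - r) * qfact_inv q (int n + s)" (is "sum ?g _ = _")
proof (cases "int n < r")
  case True
  thus ?thesis by simp
next
  case False
  define M where "M = nat (int n - r)"
  have M: "int M = int n - r" using False by (simp add: M_def)
  let ?h = "\<lambda>m. q powi (m * (m + (r + s))) * qfact_inv q (int M - m) * qfact_inv q m * qfact_inv q (m + (r + s))"
  have "sum ?g {..n} = sum ?h {0..int M}"
  proof (rule sum.reindex_bij_witness_not_neutral)
    show "finite {k. k \<le> n \<and> (int k < r \<or> int k < - s)}" by simp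
    show "finite {m \<in> {0..int M}. m + (r + s) < 0}" by (rule finite_subset[of _ "{0..int M}"]) auto
    show "int k - r \<in> {0..int M} - {m \<in> {0..int M}. m + (r + s) < 0}"
      if "k \<in> {..n} - {k. k \<le> n \<and> (int k < r \<or> int k < - s)}" for k
      using that M by auto
    show "nat (m + r) \<in> {..n} - {k. k \<le> n \<and> (int k < r \<or> int k < - s)}"
      if "m \<in> {0..int M} - {m \<in> {0..int M}. m + (r + s) < 0}" for m
      using that M rs by auto
    show "int (nat (m + r)) - r = m"
      if "m \<in> {0..int M} - {m \<in> {0..int M}. m + (r + s) < 0}" for m
      using that rs by auto
    show "nat (int k - r + r) = k" for k by simp
    show "?g k = 0" if "k \<in> {k. k \<le> n \<and> (int k < r \<or> int k < - s)}" for k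
      using that by auto
    show "?h m = 0" if "m \<in> {m \<in> {0..int M}. m + (r + s) < 0}" for m
      using that by auto
    show "?h (int k - r) = ?g k" for k
      unfolding M by (simp add: algebra_simps)
  qed
  also have "\<dots> = qfact_inv q (int M) * qfact_inv q (int M + (r + s))" by (rule qVandermonde[OF q])
  finally show ?thesis unfolding M by (simp add: algebra_simps)
qed

text \<open>
  Insert the two expansions of \<open>bailey_pair\<close> and sum over \<open>k\<close> with \<open>bailey_kernel\<close>, taking
  \<open>s = r\<close> for the first and \<open>s = r + 1\<close> for the second. Since both expansions have the same
  coefficients, what multiplies each coefficient is, up to a common factor,
  \<open>1 / (Q;Q)_(n+r) + Q^(n+r+1) / (Q;Q)_(n+r+1) = 1 / (Q;Q)_(n+r+1)\<close>, where \<open>Q = q^2\<close>. Thus the two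
  sums of different type merge into one relative to \<open>a = Q\<close>, to which \<open>durfee_rectangle\<close>
  applies.
\<close>
lemma bailey_step:
  assumes q: "norm q < 1" "q \<noteq> 0"
  defines "\<rho> \<equiv> qfact_inv (q^2)"
  shows "(\<Sum>k\<le>n. (q^2) ^ (k^2) * \<rho> (int n - int k) *
            (1 / (qpoch (q^4) (q^4) k * qpoch (-q) (q^2) k)
              + (q^2) ^ (n + k + 1) / (qpoch (q^4) (q^4) k * qpoch (-q) (q^2) (Suc k))))
         = (\<Sum>r=-int n-1..int n. theta_coeff q r * (q^2) powi (r^2) * \<rho> (int n - r) * \<rho> (int n + r + 1))"
proof -
  define Q where "Q = q^2"
  have Q: "norm Q < 1" "Q \<noteq> 0" unfolding Q_def using q by (simp_all add: norm_power abs_square_less_1)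
  have r_def: "\<rho> = qfact_inv Q" by (simp add: \<rho>_def Q_def)
  let ?R = "{-int n-1..int n}"
  have pair0: "1 / (qpoch (q^4) (q^4) k * qpoch (-q) (q^2) k) = (\<Sum>r\<in>?R. theta_coeff q r * \<rho> (int k - r) * \<rho> (int k + r))"
   and pair1: "1 / (qpoch (q^4) (q^4) k * qpoch (-q) (q^2) (Suc k)) = (\<Sum>r\<in>?R. theta_coeff q r * \<rho> (int k - r) * \<rho> (int k + r + 1))"
    if "k \<le> n" for k
    unfolding bailey_pair[OF q] \<rho>_def using that
    by (intro sum.mono_neutral_left; force simp: qfact_inv_def)+
  have ker0: "(\<Sum>k\<le>n. Q powi (int k^2) * \<rho> (int n - int k) * \<rho> (int k - r) * \<rho> (int k + r))
      = Q powi (r^2) * \<rho> (int n - r) * \<rho> (int n + r)" for r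
  proof -
    have e: "Q powi (int k^2) = Q powi (r^2) * Q powi ((int k - r) * (int k + r))" for k
      using Q by (simp add: power2_eq_square algebra_simps flip: power_int_add)
    show ?thesis
      using arg_cong[OF bailey_kernel[OF Q, of r r n], of "\<lambda>x. Q powi (r^2) * x"]
      unfolding e r_def sum_distrib_left by (simp add: mult_ac linear)
  qed
  have ker1: "(\<Sum>k\<le>n. Q powi (int k^2 + int k) * \<rho> (int n - int k) * \<rho> (int k - r) * \<rho> (int k + r + 1))
      = Q powi (r^2 + r) * \<rho> (int n - r) * \<rho> (int n + r + 1)" for r
  proof -
    have e: "Q powi (int k^2 + int k) = Q powi (r^2 + r) * Q powi ((int k - r) * (int k + (r + 1)))" for k
      using Q by (simp add: power2_eq_square algebra_simps flip: power_int_add)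
    have "0 \<le> r \<or> r + 1 \<le> 0" by linarith
    from arg_cong[OF bailey_kernel[OF Q this, of n], of "\<lambda>x. Q powi (r^2 + r) * x"] show ?thesis
      unfolding e r_def sum_distrib_left by (simp add: mult_ac add_ac)
  qed
  have "(\<Sum>k\<le>n. (q^2) ^ (k^2) * \<rho> (int n - int k) *
            (1 / (qpoch (q^4) (q^4) k * qpoch (-q) (q^2) k)
              + (q^2) ^ (n + k + 1) / (qpoch (q^4) (q^4) k * qpoch (-q) (q^2) (Suc k))))
     = (\<Sum>k\<le>n. \<Sum>r\<in>?R. theta_coeff q r *
          (Q powi (int k^2) * \<rho> (int n - int k) * \<rho> (int k - r) * \<rho> (int k + r)
           + Q powi (int n + 1) * (Q powi (int k^2 + int k) * \<rho> (int n - int k) * \<rho> (int k - r) * \<rho> (int k + r + 1))))"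
  proof (rule sum.cong)
    fix k assume "k \<in> {..n}"
    hence k: "k \<le> n" by simp
    have e: "(q^2) ^ (k^2) = Q powi (int k^2)" 
      unfolding Q_def power_int_of_nat [symmetric] by simp
    have e': "(q^2) ^ (n + k + 1) = Q powi (int n + 1) * Q powi int k" 
      using Q unfolding Q_def by (simp add: power_int_add power_add)
    have *: "(q^2) ^ (n + k + 1) / (qpoch (q^4) (q^4) k * qpoch (-q) (q^2) (Suc k)) =
       Q powi (int n + 1) * Q powi int k * (1 / (qpoch (q^4) (q^4) k * qpoch (-q) (q^2) (Suc k)))"
      unfolding e' by simp
    show "(q^2) ^ (k^2) * \<rho> (int n - int k) *
            (1 / (qpoch (q^4) (q^4) k * qpoch (-q) (q^2) k)
              + (q^2) ^ (n + k + 1) / (qpoch (q^4) (q^4) k * qpoch (-q) (q^2) (Suc k)))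
       = (\<Sum>r\<in>?R. theta_coeff q r *
          (Q powi (int k^2) * \<rho> (int n - int k) * \<rho> (int k - r) * \<rho> (int k + r)
           + Q powi (int n + 1) * (Q powi (int k^2 + int k) * \<rho> (int n - int k) * \<rho> (int k - r) * \<rho> (int k + r + 1))))"
      unfolding * pair0[OF k] pair1[OF k] e sum_distrib_left sum.distrib [symmetric]
      using Q by (intro sum.cong) (simp_all add: power_int_add algebra_simps)
  qed simp
  also have "\<dots> = (\<Sum>r\<in>?R. theta_coeff q r *
          ((\<Sum>k\<le>n. Q powi (int k^2) * \<rho> (int n - int k) * \<rho> (int k - r) * \<rho> (int k + r))
           + Q powi (int n + 1) * (\<Sum>k\<le>n. Q powi (int k^2 + int k) * \<rho> (int n - int k) * \<rho> (int k - r) * \<rho> (int k + r + 1))))"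
    by (subst sum.swap) (simp only: sum_distrib_left sum.distrib distrib_left)
  also have "\<dots> = (\<Sum>r\<in>?R. theta_coeff q r * Q powi (r^2) * \<rho> (int n - r) * \<rho> (int n + r + 1))"
  proof (rule sum.cong)
    fix r
    have "\<rho> (int n + r) + Q powi (int n + 1 + r) * \<rho> (int n + r + 1) = \<rho> (int n + r + 1)"
      using qfact_inv_rec[OF Q(1), of "int n + r + 1"] unfolding r_def by (simp add: algebra_simps)
    from arg_cong[OF this, of "\<lambda>x. theta_coeff q r * Q powi (r^2) * \<rho> (int n - r) * x"]
    show "theta_coeff q r *
          ((\<Sum>k\<le>n. Q powi (int k^2) * \<rho> (int n - int k) * \<rho> (int k - r) * \<rho> (int k + r))
           + Q powi (int n + 1) * (\<Sum>k\<le>n. Q powi (int k^2 + int k) * \<rho> (int n - int k) * \<rho> (int k - r) * \<rho> (int k + r + 1)))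
       = theta_coeff q r * Q powi (r^2) * \<rho> (int n - r) * \<rho> (int n + r + 1)"
      unfolding ker0 ker1 using Q by (simp add: power_int_add algebra_simps)
  qed simp
  finally show ?thesis unfolding Q_def .
qed

section \<open>Evaluation of the bilateral series\<close>

text \<open>
  Base \<open>q^a\<close> and \<open>x = -q^b\<close>: the form in which theta series of modulus \<open>a\<close> occur.
\<close>
lemma jacobi_triple_powers:
  fixes q :: complex and a b c :: nat
  assumes q: "norm q < 1" "q \<noteq> 0" and abc: "a = b + c" "a > 0"
  shows "((\<lambda>r. (-1) powi r * q powi (int a * (r * (r - 1) div 2) + int b * r))
            has_sum (qpoch_inf (q^a) (q^a) * qpoch_inf (q^b) (q^a) * qpoch_inf (q^c) (q^a))) UNIV"
proof -
  have qa: "norm (q^a) < 1" "q^a \<noteq> 0" using q abc(2) by (simp_all add: norm_power power_less_one_iff)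
  have "(q^a) powi (r * (r - 1) div 2) * (- (q^b)) powi r
      = (-1) powi r * q powi (int a * (r * (r - 1) div 2) + int b * r)" for r
  proof -
    have "(- (q^b)) powi r = (-1) powi r * (q^b) powi r"
      by (simp flip: power_int_mult_distrib)
    thus ?thesis using q by (simp only: power_int_power) (simp add: power_int_add)
  qed
  moreover have "- (q^a / - (q^b)) = q^c" using q abc(1) by (simp add: power_add)
  moreover have "- (q^b) \<noteq> 0" using q by simp
  ultimately show ?thesis using jacobi_triple[OF qa, of "- (q^b)"] by simp
qed

text \<open>
  Exchange the two summations. For fixed \<open>r\<close> the sum over \<open>n\<close> is that of \<open>durfee_rectangle\<close>
  with \<open>m = n - r\<close> and \<open>t = 2r + 1\<close>. What remains is the theta series
  with exponents \<open>(3r^2 + r)/2 + 2r^2 + 2(r^2 + r) = (11r^2 + 5r)/2\<close>, a case of the triple product.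
\<close>
lemma bilateral_evaluation:
  assumes q: "norm q < 1" "q \<noteq> 0"
  defines "Q \<equiv> q^2"
  defines "\<rho> \<equiv> qfact_inv Q"
  shows "((\<lambda>n. Q ^ (n^2 + n) * (\<Sum>r=-int n-1..int n. theta_coeff q r * Q powi (r^2) * \<rho> (int n - r) * \<rho> (int n + r + 1)))
           has_sum (qpoch_inf_list [q^3, q^8, q^11] (q^11) / qpoch_inf Q Q)) UNIV"
proof -
  define P where "P = qpoch_inf Q Q"
  have Q: "norm Q < 1" "Q \<noteq> 0" unfolding Q_def using q by (simp_all add: norm_power abs_square_less_1)
  define F where "F = (\<lambda>(n, r). Q ^ (n^2 + n) * (theta_coeff q r * Q powi (r^2) * \<rho> (int n - r) * \<rho> (int n + r + 1)))"
  obtain C where C: "C \<ge> 1" "\<And>n. norm (\<rho> n) \<le> C"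
    unfolding \<rho>_def using qfact_inv_bounded[OF Q(1)] by blast
  have summ: "F summable_on (UNIV \<times> UNIV)"
  proof -
    \<comment> \<open>The triple product in base q^3 is used here only for summability of the coefficients,
      which dominates the double family together with a geometric series in n.\<close>
    have "theta_coeff q r = (-1) powi r * q powi (int 3 * (r * (r - 1) div 2) + int 2 * r)" for r
    proof -
      have "2 * (r * (3 * r + 1) div 2) = 2 * (3 * (r * (r - 1) div 2) + 2 * r)"
        unfolding distrib_left mult.left_commute[of 2 3] twice_triangle twice_pentagonal by (simp add: algebra_simps)
      hence "r * (3 * r + 1) div 2 = 3 * (r * (r - 1) div 2) + 2 * r" by simp
      thus ?thesis unfolding theta_coeff_def by simp
    qed
    hence "theta_coeff q = (\<lambda>r. (-1) powi r * q powi (int 3 * (r * (r - 1) div 2) + int 2 * r))"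
      by (rule ext)
    hence theta_summable: "theta_coeff q summable_on UNIV"
      using has_sum_imp_summable[OF jacobi_triple_powers[OF q, of 3 2 1]] by simp
    have "(\<lambda>n. norm (complex_of_real (norm Q) ^ n)) summable_on UNIV"
      using Q by (auto intro!: summable_nonneg_imp_summable_on summable_geometric simp: norm_power)
    hence "(\<lambda>x. norm (case x of (n, r) \<Rightarrow> complex_of_real (norm Q) ^ n * theta_coeff q r)) summable_on (UNIV \<times> UNIV)"
      using theta_summable unfolding summable_on_iff_abs_summable_on_complex
      by (rule abs_summable_on_Times)
    hence "(\<lambda>x. norm (complex_of_real (C * C) * (case x of (n, r) \<Rightarrow> complex_of_real (norm Q) ^ n * theta_coeff q r))) summable_on (UNIV \<times> UNIV)"
      unfolding norm_mult by (rule summable_on_cmult_right)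
    hence "(\<lambda>x. norm (F x)) summable_on (UNIV \<times> UNIV)"
    proof (rule Infinite_Sum.abs_summable_on_comparison_test, clarify)
      fix n :: nat and r :: int
      have "norm Q ^ (n^2 + n) \<le> norm Q ^ n" using Q by (intro power_decreasing) auto
      moreover have "norm Q powi (r^2) \<le> 1" using Q by (intro power_int_le_one) auto
      ultimately have "norm (F (n, r)) \<le> norm Q ^ n * (norm (theta_coeff q r) * 1 * C * C)"
        unfolding F_def prod.case norm_mult norm_power norm_power_int using C Q
        by (intro mult_mono mult_nonneg_nonneg norm_ge_zero zero_le_power zero_le_power_int order.refl) auto
      thus "norm (F (n, r)) \<le> norm (complex_of_real (C * C) * (complex_of_real (norm Q) ^ n * theta_coeff q r))"
        using C by (simp add: norm_mult norm_power mult_ac)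
    qed
    thus ?thesis by (rule Infinite_Sum.abs_summable_summable)
  qed
  then obtain S where S: "(F has_sum S) (UNIV \<times> UNIV)" by (auto simp: summable_on_def)
  have rows: "((\<lambda>n. Q ^ (n^2 + n) * (\<Sum>r=-int n-1..int n. theta_coeff q r * Q powi (r^2) * \<rho> (int n - r) * \<rho> (int n + r + 1)))
           has_sum S) UNIV"
  proof (rule has_sum_SigmaD[OF S])
    fix n :: nat
    show "((\<lambda>r. F (n, r)) has_sum Q ^ (n^2 + n) * (\<Sum>r=-int n-1..int n. theta_coeff q r * Q powi (r^2) * \<rho> (int n - r) * \<rho> (int n + r + 1))) UNIV"
      by (rule has_sum_finite_neutralI[of "{-int n-1..int n}"])
         (auto simp: F_def \<rho>_def sum_distrib_left qfact_inv_def)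
  qed
  have "((\<lambda>r. theta_coeff q r * Q powi (r^2) * (Q powi (r^2 + r) * (1 / P))) has_sum S) UNIV"
  proof (rule has_sum_SigmaD)
    show "((\<lambda>(r, n). F (n, r)) has_sum S) (UNIV \<times> UNIV)"
      using S by (subst (asm) has_sum_swap) auto
    fix r :: int
    have "((\<lambda>m. Q powi (m * (m + (2 * r + 1))) * \<rho> m * \<rho> (m + (2 * r + 1))) has_sum (1 / P)) UNIV"
      unfolding \<rho>_def P_def by (rule durfee_rectangle[OF Q])
    hence "((\<lambda>n. Q powi ((n - r) * (n + r + 1)) * \<rho> (n - r) * \<rho> (n + r + 1)) has_sum (1 / P)) UNIV"
      by (subst has_sum_reindex_bij_witness[where i = "\<lambda>m. m + r" and j = "\<lambda>n. n - r"]) (auto simp: algebra_simps)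
    hence "((\<lambda>n. Q powi (r^2 + r) * (Q powi ((n - r) * (n + r + 1)) * \<rho> (n - r) * \<rho> (n + r + 1))) has_sum (Q powi (r^2 + r) * (1 / P))) UNIV"
      by (rule has_sum_cmult_right)
    hence "((\<lambda>n. Q powi (r^2 + r) * (Q powi ((int n - r) * (int n + r + 1)) * \<rho> (int n - r) * \<rho> (int n + r + 1))) has_sum (Q powi (r^2 + r) * (1 / P))) UNIV"
      by (subst (asm) has_sum_int_iff_nat) (auto simp: \<rho>_def qfact_inv_def)
    moreover have "Q powi (r^2 + r) * Q powi ((int n - r) * (int n + r + 1)) = Q ^ (n^2 + n)" for n
    proof -
      have "Q ^ (n^2 + n) = Q powi (r^2 + r + (int n - r) * (int n + r + 1))"
        unfolding power_int_of_nat [symmetric] by (simp add: power2_eq_square algebra_simps)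
      thus ?thesis using Q by (simp add: power_int_add)
    qed
    ultimately have "((\<lambda>n. Q ^ (n^2 + n) * \<rho> (int n - r) * \<rho> (int n + r + 1)) has_sum (Q powi (r^2 + r) * (1 / P))) UNIV"
      by (simp only: mult.assoc [symmetric])
    hence "((\<lambda>n. theta_coeff q r * Q powi (r^2) * (Q ^ (n^2 + n) * \<rho> (int n - r) * \<rho> (int n + r + 1)))
              has_sum theta_coeff q r * Q powi (r^2) * (Q powi (r^2 + r) * (1 / P))) UNIV"
      by (rule has_sum_cmult_right)
    thus "((\<lambda>n. case (r, n) of (r, n) \<Rightarrow> F (n, r)) has_sum theta_coeff q r * Q powi (r^2) * (Q powi (r^2 + r) * (1 / P))) UNIV"
      by (simp add: F_def mult_ac)
  qed
  also have "(\<lambda>r. theta_coeff q r * Q powi (r^2) * (Q powi (r^2 + r) * (1 / P)))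
      = (\<lambda>r. (-1) powi r * q powi (int 11 * (r * (r - 1) div 2) + int 8 * r) * (1 / P))"
  proof
    fix r :: int
    have "2 * (11 * (r * (r - 1) div 2) + 8 * r) = 2 * (r * (3 * r + 1) div 2 + 2 * r^2 + 2 * (r^2 + r))"
      unfolding distrib_left mult.left_commute[of 2 11] twice_triangle twice_pentagonal by (simp add: algebra_simps power2_eq_square)
    hence e: "11 * (r * (r - 1) div 2) + 8 * r = r * (3 * r + 1) div 2 + 2 * r^2 + 2 * (r^2 + r)" by simp
    have "q powi (int 11 * (r * (r - 1) div 2) + int 8 * r) = q powi (r * (3 * r + 1) div 2) * q powi (2 * r^2) * q powi (2 * (r^2 + r))"
      unfolding of_nat_numeral e using q by (simp only: power_int_add simp_thms)
    thus "theta_coeff q r * Q powi (r^2) * (Q powi (r^2 + r) * (1 / P)) = (-1) powi r * q powi (int 11 * (r * (r - 1) div 2) + int 8 * r) * (1 / P)"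
      unfolding theta_coeff_def Q_def power2_powi by (simp only: mult_ac)
  qed
  finally have "((\<lambda>r. (-1) powi r * q powi (int 11 * (r * (r - 1) div 2) + int 8 * r) * (1 / P)) has_sum S) UNIV" .
  moreover have "((\<lambda>r. (-1) powi r * q powi (int 11 * (r * (r - 1) div 2) + int 8 * r) * (1 / P))
     has_sum (qpoch_inf (q^11) (q^11) * qpoch_inf (q^8) (q^11) * qpoch_inf (q^3) (q^11) * (1 / P))) UNIV"
    by (rule has_sum_cmult_left[OF jacobi_triple_powers[OF q]]) auto
  ultimately have "S = qpoch_inf (q^11) (q^11) * qpoch_inf (q^8) (q^11) * qpoch_inf (q^3) (q^11) * (1 / P)"
    by (rule has_sum_unique)
  thus ?thesis using rows by (simp add: qpoch_inf_list_def P_def mult_ac)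
qed

section \<open>The triple sum\<close>

text \<open>
  The factors \<open>1 - q^(2m+1)\<close> and \<open>1 + q^(2m+1)\<close> multiply to \<open>1 - q^(4m+2)\<close>, which together with
  the factors \<open>1 - q^(4m+4)\<close> run through all \<open>1 - q^(2m+2)\<close>.
\<close>
lemma qpoch_inf_dissection:
  assumes q: "norm q < 1"
  shows "qpoch_inf q (q^2) * qpoch_inf (-q) (q^2) * qpoch_inf (q^4) (q^4) = qpoch_inf (q^2) (q^2)"
proof -
  have q2: "norm (q^2) < 1" "norm (q^4) < 1" using q by (simp_all add: norm_power power_less_one_iff)
  have "qpoch q (q^2) n * qpoch (-q) (q^2) n * qpoch (q^4) (q^4) n = qpoch (q^2) (q^2) (2 * n)" for n
  proof (induction n)
    case (Suc n)
    have "2 * Suc n = Suc (Suc (2 * n))" by simp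
    have "qpoch q (q^2) (Suc n) * qpoch (-q) (q^2) (Suc n) * qpoch (q^4) (q^4) (Suc n)
       = qpoch (q^2) (q^2) (2 * n) * ((1 - q * (q^2) ^ n) * (1 + q * (q^2) ^ n)) * (1 - q^4 * (q^4)^n)"
      unfolding Suc.IH [symmetric] qpoch_Suc by simp
    also have "(1 - q * (q^2) ^ n) * (1 + q * (q^2) ^ n) = 1 - q^2 * (q^2) ^ (2 * n)"
    proof -
      have "(q * (q^2) ^ n)^2 = q^2 * (q^2) ^ (2 * n)"
        by (simp add: power_mult_distrib mult_ac flip: power_mult)
      moreover have "(1 - y) * (1 + y) = 1 - y^2" for y :: complex
        by (simp add: algebra_simps power2_eq_square)
      ultimately show ?thesis by simp
    qed
    also have "q^4 * (q^4)^n = q^2 * (q^2) ^ (Suc (2 * n))"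
    proof -
      have "q ^ (4 + 4 * n) = q ^ (2 + 2 * Suc (2 * n))" by (rule arg_cong) simp
      thus ?thesis by (simp only: power_add power_mult)
    qed
    also have "qpoch (q^2) (q^2) (2 * n) * (1 - q^2 * (q^2) ^ (2 * n)) * (1 - q^2 * (q^2) ^ (Suc (2 * n))) = qpoch (q^2) (q^2) (2 * Suc n)"
      by (simp add: qpoch_Suc)
    finally show ?case .
  qed simp
  moreover have "(\<lambda>n. qpoch q (q^2) n * qpoch (-q) (q^2) n * qpoch (q^4) (q^4) n)
      \<longlonglongrightarrow> qpoch_inf q (q^2) * qpoch_inf (-q) (q^2) * qpoch_inf (q^4) (q^4)"
    by (intro tendsto_mult qpoch_tendsto q2)
  moreover have "(\<lambda>n. qpoch (q^2) (q^2) (2 * n)) \<longlonglongrightarrow> qpoch_inf (q^2) (q^2)"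
    using LIMSEQ_subseq_LIMSEQ[OF qpoch_tendsto(1)[OF q2(1)], of "\<lambda>n. 2 * n" "q^2"]
    by (simp add: strict_mono_def o_def)
  ultimately show ?thesis by (metis (no_types, lifting) LIMSEQ_unique ext)
qed

definition triple_summand :: "complex \<Rightarrow> nat \<times> nat \<times> nat \<Rightarrow> complex" where
  "triple_summand q = (\<lambda>(i, j, k).
            q ^ (i^2 + 2*j^2 + 4*k^2 + 2*i*k + 4*j*k + 2*j + 2*k)
              * (1 + q ^ (2*i + 2*j + 4*k + 2))
            / (qpoch (q^2) (q^2) i * qpoch (q^2) (q^2) j * qpoch (q^4) (q^4) k))"

text \<open>
  The exponent is at least \<open>i + j + k\<close> and the reciprocal finite products are bounded.
\<close>
lemma summable_triple_summand:
  assumes q: "norm q < 1"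
  shows "triple_summand q summable_on UNIV"
proof -
  have q2: "norm (q^2) < 1" "norm (q^4) < 1" using q by (simp_all add: norm_power power_less_one_iff)
  obtain C where C: "C \<ge> 1" "\<And>n. norm (qfact_inv (q^2) n) \<le> C"
    using qfact_inv_bounded[OF q2(1)] by blast
  obtain D where D: "D \<ge> 1" "\<And>n. norm (qfact_inv (q^4) n) \<le> D"
    using qfact_inv_bounded[OF q2(2)] by blast
  define x where "x = norm q"
  have x: "0 \<le> x" "x < 1" using q by (auto simp: x_def)
  have g: "(\<lambda>n. norm (x ^ n)) summable_on UNIV"
    using x by (auto intro!: summable_nonneg_imp_summable_on summable_geometric)
  have "(\<lambda>z. norm (case z of (i, y) \<Rightarrow> x ^ i * (case y of (j, k) \<Rightarrow> x ^ j * x ^ k))) summable_on (UNIV \<times> (UNIV \<times> UNIV))"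
    by (intro abs_summable_on_Times g)
  hence "(\<lambda>z. norm ((2 * C * C * D) * (case z of (i, y) \<Rightarrow> x ^ i * (case y of (j, k) \<Rightarrow> x ^ j * x ^ k)))) summable_on UNIV"
    unfolding norm_mult UNIV_Times_UNIV by (rule summable_on_cmult_right)
  hence "(\<lambda>z. norm (triple_summand q z)) summable_on UNIV"
  proof (rule Infinite_Sum.abs_summable_on_comparison_test, clarify)
    fix i j k :: nat
    let ?e = "i^2 + 2*j^2 + 4*k^2 + 2*i*k + 4*j*k + 2*j + 2*k"
    have "i \<le> i^2" by (simp add: power2_eq_square)
    hence "i + j + k \<le> ?e" by linarith
    hence 1: "x ^ ?e \<le> x ^ (i + j + k)" using x by (intro power_decreasing) auto
    have "norm (1 + q ^ (2*i + 2*j + 4*k + 2)) \<le> norm (1::complex) + norm (q ^ (2*i + 2*j + 4*k + 2))"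
      by (rule norm_triangle_ineq)
    also have "norm (q ^ (2*i + 2*j + 4*k + 2)) \<le> 1"
      unfolding norm_power using q by (intro power_le_one) auto
    finally have 2: "norm (1 + q ^ (2*i + 2*j + 4*k + 2)) \<le> 2" by simp
    have "norm (triple_summand q (i, j, k)) = x ^ ?e * norm (1 + q ^ (2*i + 2*j + 4*k + 2))
        * (norm (qfact_inv (q^2) (int i)) * norm (qfact_inv (q^2) (int j)) * norm (qfact_inv (q^4) (int k)))"
      by (simp add: triple_summand_def norm_mult norm_divide norm_power x_def)
    also have "\<dots> \<le> x ^ (i + j + k) * 2 * (C * C * D)"
      using 1 2 C D x by (intro mult_mono mult_nonneg_nonneg norm_ge_zero) (auto simp del: qfact_inv_of_nat)
    also have "\<dots> = norm (2 * C * C * D * (x ^ i * (x ^ j * x ^ k)))"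
      using C D x by (simp add: power_add)
    finally show "norm (triple_summand q (i, j, k)) \<le> norm (2 * C * C * D * (x ^ i * (x ^ j * x ^ k)))" .
  qed
  thus ?thesis by (rule Infinite_Sum.abs_summable_summable)
qed

text \<open>
  With \<open>n = j + k\<close> the exponent becomes \<open>2(n^2 + n) + 2k^2 + (i^2 + 2ik)\<close>. The two terms of the
  factor \<open>1 + q^(2i+2j+4k+2)\<close> then give two of Euler's sums over \<open>i\<close>, with products starting at
  \<open>q^(2k+1)\<close> and \<open>q^(2k+3)\<close>; both are \<open>(-q;q^2)_\<infinity>\<close> divided by a finite product.
\<close>
lemma triple_summand_sum_first:
  assumes q: "norm q < 1" and k: "k \<le> n"
  shows "((\<lambda>i. triple_summand q (i, n - k, k)) has_sum
     (qpoch_inf (-q) (q^2) * (q^2) ^ (n^2 + n) * ((q^2) ^ (k^2) * qfact_inv (q^2) (int n - int k) *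
            (1 / (qpoch (q^4) (q^4) k * qpoch (-q) (q^2) k)
              + (q^2) ^ (n + k + 1) / (qpoch (q^4) (q^4) k * qpoch (-q) (q^2) (Suc k)))))) UNIV"
proof -
  define Q where "Q = q^2"
  define E where "E = qpoch_inf (-q) Q"
  have Q: "norm Q < 1" unfolding Q_def using q by (simp add: norm_power abs_square_less_1)
  have nz: "qpoch (-q) Q m \<noteq> 0" for m
    using one_plus_power_nonzero[OF q, of "2 * l + 1" for l]
    by (auto simp: qpoch_def Q_def power_mult)
  have shifted: "((\<lambda>i. q ^ (i^2 + 2 * i * m) / qpoch Q Q i) has_sum (E / qpoch (-q) Q m)) UNIV" for m
  proof -
    have "qpoch_inf (- (q * Q ^ m)) Q = E / qpoch (-q) Q m"
      using qpoch_inf_split[OF Q, of "-q" m] nz[of m] by (simp add: E_def field_simps)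
    moreover have "Q ^ (i * (i - 1) div 2) * (q * Q ^ m) ^ i = q ^ (i^2 + 2 * i * m)" for i
    proof -
      have "2 * (i * (i - 1) div 2) = i * (i - 1)" by (cases i) auto
      hence "Q ^ (i * (i - 1) div 2) = q ^ (i * (i - 1))" unfolding Q_def power_mult [symmetric] by simp
      moreover have "(q * Q ^ m) ^ i = q ^ (i + 2 * i * m)"
        by (simp add: Q_def power_mult_distrib power_add mult_ac flip: power_mult)
      moreover have "i * (i - 1) + (i + 2 * i * m) = i^2 + 2 * i * m"
        by (cases i) (auto simp: power2_eq_square algebra_simps)
      ultimately show ?thesis by (metis power_add)
    qed
    ultimately show ?thesis using euler_qexp[OF Q, of "q * Q ^ m"] by simp
  qed
  define A where "A = Q ^ (n^2 + n) * Q ^ (k^2) * qfact_inv Q (int n - int k) / qpoch (q^4) (q^4) k"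
  have "((\<lambda>i. A * (q ^ (i^2 + 2 * i * k) / qpoch Q Q i + Q ^ (n + k + 1) * (q ^ (i^2 + 2 * i * Suc k) / qpoch Q Q i)))
     has_sum (A * (E / qpoch (-q) Q k + Q ^ (n + k + 1) * (E / qpoch (-q) Q (Suc k))))) UNIV"
    by (intro has_sum_cmult_right has_sum_add shifted)
  also have "(\<lambda>i. A * (q ^ (i^2 + 2 * i * k) / qpoch Q Q i + Q ^ (n + k + 1) * (q ^ (i^2 + 2 * i * Suc k) / qpoch Q Q i)))
      = (\<lambda>i. triple_summand q (i, n - k, k))"
  proof
    fix i
    obtain j where n: "n = j + k" using k by (metis le_add_diff_inverse2)
    have e: "i^2 + 2*j^2 + 4*k^2 + 2*i*k + 4*j*k + 2*j + 2*k = 2 * (n^2 + n) + 2 * k^2 + (i^2 + 2 * i * k)"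
      unfolding n by (simp add: power2_eq_square algebra_simps)
    have e': "2*i + 2*j + 4*k + 2 = 2 * (n + k + 1) + 2 * i" unfolding n by simp
    have "q ^ (i^2 + 2*j^2 + 4*k^2 + 2*i*k + 4*j*k + 2*j + 2*k) = Q ^ (n^2 + n) * Q ^ (k^2) * q ^ (i^2 + 2 * i * k)"
      unfolding e Q_def by (simp only: power_add power_mult)
    moreover have "q ^ (2*i + 2*j + 4*k + 2) = Q ^ (n + k + 1) * q ^ (2 * i)"
      unfolding e' Q_def by (simp only: power_add power_mult)
    moreover have "qfact_inv Q (int n - int k) = 1 / qpoch Q Q j" unfolding n by simp
    moreover have "q ^ (i^2 + 2 * i * Suc k) = q ^ (i^2 + 2 * i * k) * q ^ (2 * i)"
      by (simp flip: power_add add: algebra_simps)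
    moreover have "n - k = j" unfolding n by simp
    ultimately show "A * (q ^ (i^2 + 2 * i * k) / qpoch Q Q i + Q ^ (n + k + 1) * (q ^ (i^2 + 2 * i * Suc k) / qpoch Q Q i)) = triple_summand q (i, n - k, k)"
      unfolding triple_summand_def A_def prod.case Q_def [symmetric] by (simp add: algebra_simps add_divide_distrib)
  qed
  also have "A * (E / qpoch (-q) Q k + Q ^ (n + k + 1) * (E / qpoch (-q) Q (Suc k)))
     = E * Q ^ (n^2 + n) * (Q ^ (k^2) * qfact_inv Q (int n - int k) *
            (1 / (qpoch (q^4) (q^4) k * qpoch (-q) Q k) + Q ^ (n + k + 1) / (qpoch (q^4) (q^4) k * qpoch (-q) Q (Suc k))))"
    unfolding A_def by (simp add: algebra_simps add_divide_distrib)
  finally show ?thesis unfolding E_def Q_def .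
qed

theorem theorem3p18:
  fixes q :: complex
  assumes "norm q < 1"
  shows "((\<lambda>(i, j, k).
            q ^ (i^2 + 2*j^2 + 4*k^2 + 2*i*k + 4*j*k + 2*j + 2*k)
              * (1 + q ^ (2*i + 2*j + 4*k + 2))
            / (qpoch (q^2) (q^2) i * qpoch (q^2) (q^2) j * qpoch (q^4) (q^4) k))
          has_sum
          (qpoch_inf_list [q^3, q^8, q^11] (q^11)
            / (qpoch_inf q (q^2) * qpoch_inf (q^4) (q^4))))
         (UNIV :: (nat \<times> nat \<times> nat) set)"
proof (cases "q = 0")
  case True
  have "qpoch_inf 0 0 = 1" unfolding qpoch_inf_def by simp
  moreover have "((\<lambda>(i, j, k).
            q ^ (i^2 + 2*j^2 + 4*k^2 + 2*i*k + 4*j*k + 2*j + 2*k)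
              * (1 + q ^ (2*i + 2*j + 4*k + 2))
            / (qpoch (q^2) (q^2) i * qpoch (q^2) (q^2) j * qpoch (q^4) (q^4) k)) has_sum 1) UNIV"
    by (rule has_sum_finite_neutralI[of "{(0, 0, 0)}"]) (auto simp: True)
  ultimately show ?thesis by (simp add: True qpoch_inf_list_def)
next
  case False
  note q = assms False
  have q2: "norm (q^2) < 1" using q by (simp add: norm_power abs_square_less_1)
  define S where "S = infsum (triple_summand q) UNIV"
  define E where "E = qpoch_inf (-q) (q^2)"
  have S: "(triple_summand q has_sum S) UNIV"
    unfolding S_def using summable_triple_summand[OF q(1)] by (rule has_sum_infsum)
  hence "((\<lambda>((n, k), i). triple_summand q (i, n - k, k)) has_sum S) ((SIGMA n:UNIV. {..n}) \<times> UNIV)"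
    by (subst has_sum_reindex_bij_witness[where i = "\<lambda>(i, j, k). ((j + k, k), i)" and j = "\<lambda>((n, k), i). (i, n - k, k)"]) auto
  hence "((\<lambda>(n, k). E * (q^2) ^ (n^2 + n) * ((q^2) ^ (k^2) * qfact_inv (q^2) (int n - int k) *
            (1 / (qpoch (q^4) (q^4) k * qpoch (-q) (q^2) k)
              + (q^2) ^ (n + k + 1) / (qpoch (q^4) (q^4) k * qpoch (-q) (q^2) (Suc k))))) has_sum S) (SIGMA n:UNIV. {..n})"
    by (rule has_sum_SigmaD) (use triple_summand_sum_first[OF q(1)] in \<open>auto simp: E_def\<close>)
  hence "((\<lambda>n. E * (q^2) ^ (n^2 + n) * (\<Sum>k\<le>n. (q^2) ^ (k^2) * qfact_inv (q^2) (int n - int k) *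
            (1 / (qpoch (q^4) (q^4) k * qpoch (-q) (q^2) k)
              + (q^2) ^ (n + k + 1) / (qpoch (q^4) (q^4) k * qpoch (-q) (q^2) (Suc k))))) has_sum S) UNIV"
    by (rule has_sum_SigmaD) (simp add: sum_distrib_left has_sum_finiteI)
  moreover have "((\<lambda>n. E * (q^2) ^ (n^2 + n) * (\<Sum>k\<le>n. (q^2) ^ (k^2) * qfact_inv (q^2) (int n - int k) *
            (1 / (qpoch (q^4) (q^4) k * qpoch (-q) (q^2) k)
              + (q^2) ^ (n + k + 1) / (qpoch (q^4) (q^4) k * qpoch (-q) (q^2) (Suc k)))))
      has_sum (E * (qpoch_inf_list [q^3, q^8, q^11] (q^11) / qpoch_inf (q^2) (q^2)))) UNIV"
    unfolding bailey_step[OF q]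
    using has_sum_cmult_right[OF bilateral_evaluation[OF q], of E] by (simp only: mult.assoc)
  ultimately have "S = E * (qpoch_inf_list [q^3, q^8, q^11] (q^11) / qpoch_inf (q^2) (q^2))"
    by (rule has_sum_unique)
  also have "\<dots> = qpoch_inf_list [q^3, q^8, q^11] (q^11) / (qpoch_inf q (q^2) * qpoch_inf (q^4) (q^4))"
  proof -
    have P: "qpoch_inf (q^2) (q^2) = E * (qpoch_inf q (q^2) * qpoch_inf (q^4) (q^4))"
      using qpoch_inf_dissection[OF q(1)] by (simp add: E_def mult_ac)
    hence "E \<noteq> 0" using qpoch_inf_nonzero[OF q2] by auto
    thus ?thesis unfolding P by simp
  qed
  finally show ?thesis using S unfolding triple_summand_def by simp
qed

end
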